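(* Each normal form word is a geodesic: every word $w$ in the language $\mathcal{NF}\subseteq\{a,a^{-1},t,t^{-1}\}^*$ defined in the context has minimal length among all words over $\{a,a^{-1},t,t^{-1}\}$ representing the same element of $BS(1,2)=\langle a,t\mid tat^{-1}=a^2\rangle$.
   Context: **Normal forms.** Words are over $\{a,a^{-1},t,t^{-1}\}$. The $t$-exponent of a word is the sum of the exponents of its $t^{\pm1}$ letters. An $N$-run is a word $a^{\epsilon_l}t^{-1}a^{\epsilon_{l-1}}t^{-1}\cdots t^{-1}a^{\epsilon_0}$, recorded by its sequence of entries $\epsilon_l\epsilon_{l-1}\cdots\epsilon_0$; a $P$-run is a word $a^{\epsilon_0}ta^{\epsilon_1}t\cdots ta^{\epsilon_l}$, recorded as $\epsilon_0\epsilon_1\cdots\epsilon_l$ (all $\epsilon_i\in\mathbb Z$). "The negative" of a sequence negates all of its entries. When several entries in a list carry $\pm$, all independent sign choices are allowed. The language $\mathcal{NF}$ is the union of the following five families of words ($\epsilon$ denotes the empty word). (1) $\epsilon, a^{\pm1},a^{\pm2},a^{\pm3}$. (2) (types $X$, $XN$, $XNP$; zero or negative $t$-exponent) Words $t^{k}a^{\epsilon_l}t^{-1}a^{\epsilon_{l-1}}t^{-1}\cdots a^{\epsilon_1}t^{-1}a^{\epsilon_0}t^{m}$ with $k>0$, $m\ge0$, $l\ge k+m$, and $\epsilon_0\ne0$ if $m>0$. If $l\ge3$: the $N$-run starts with one of $200,201,210,300,301,30(-1),310$ or the negative of one of these; all later entries are in $\{0,1,-1\}$; and no two consecutive entries are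 both nonzero, except possibly within the three-entry prefix. If $l\le2$: the word is in $L_1$, the set of words - $ta^it^{-1}a^j$, $ij=(\pm2)0,(\pm3)0,21,31,(-2)(-1),(-3)(-1)$; - $ta^it^{-1}a^jt^{-1}a^k$ and $t^2a^it^{-1}a^jt^{-1}a^k$, $ijk=(\pm2)00,(\pm3)00,201,(\pm3)01,(-2)0(-1),(\pm3)0(-1),210,310,(-2)(-1)0,(-3)(-1)0$; - $ta^it^{-1}a^jt^{-1}a^kt$, $ijk=201,(\pm3)01,(-2)0(-1),(\pm3)0(-1)$. (3) (types $N$, $NP_\le$; $t$-exponent $\le0$) Words $a^{\epsilon_l}t^{-1}a^{\epsilon_{l-1}}t^{-1}\cdots a^{\epsilon_1}t^{-1}a^{\epsilon_0}t^{k}$ with $0\le k\le l$, and $\epsilon_0\neq0$ if $k>0$. If $l\ge3$: the $N$-run starts with one of $000,001,010,100,101,10(-1),110,200,201,20(-1),210,300,301,30(-1),310$ or the negative of one of these; all later entries are in $\{0,1,-1\}$; and no two consecutive entries are both nonzero, except possibly within the three-entry prefix. If $l\le 2$: the word is in $L_2$, the set of words - $a^it^{-1}a^j$, $ij=00,(\pm1)0,(\pm2)0,(\pm3)0,0(\pm1),0(\pm2),0(\pm3),11,21,31,(-1)(-1),(-2)(-1),(-3)(-1)$; - $a^it^{-1}a^jt$, $ij=0(\pm1),0(\pm2),0(\pm3),11,21,31,(-1)(-1),(-2)(-1),(-3)(-1)$; - $a^it^{-1}a^jt^{-1}a^k$, $ijk=000,(\pm1)00,(\pm2)00,(\pm3)00,0(\pm1)0,0(\pm2)0,0(\pm3)0,00(\pm1),00(\pm2),00(\pm3),(\pm1)0(\pm1),(\pm2)0(\pm1),(\pm3)0(\pm1),110,210,310,(-1)(-1)0,(-2)(-1)0,(-3)(-1)0$;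 - $a^it^{-1}a^jt^{-1}a^kt$ and $a^it^{-1}a^jt^{-1}a^kt^2$, $ijk=00(\pm1),00(\pm2),00(\pm3),(\pm1)0(\pm1),(\pm2)0(\pm1),(\pm3)0(\pm1)$. (4) (types $P$, $NP_>$; positive $t$-exponent) Words $t^{-k}a^{\epsilon_0}ta^{\epsilon_1}t\cdots a^{\epsilon_{l-1}}ta^{\epsilon_l}$ with $0\le k<l$ and $\epsilon_0\ne0$ if $k>0$. If $l\ge3$: the $P$-run ends with one of $000,100,010,001,101,(-1)01,011,002,102,(-1)02,012,003,103,(-1)03,013$ or the negative of one of these; all earlier entries are in $\{0,1,-1\}$; and no two consecutive entries are both nonzero, except possibly within the three-entry suffix. If $l\le2$: the word (still subject to $0\le k<l$) is in $L_3$, the set of words - $a^ita^j$, $ij=00,0(\pm1),0(\pm2),0(\pm3),(\pm1)0,11,12,13,(-1)(-1),(-1)(-2),(-1)(-3)$; - $t^{-1}a^ita^j$, $ij=(\pm1)0,11,12,13,(-1)(-1),(-1)(-2),(-1)(-3)$; - $a^ita^jta^k$, $ijk=000,00(\pm1),00(\pm2),00(\pm3),(\pm1)0(\pm1),(\pm1)0(\pm2),(\pm1)0(\pm3),0(\pm1)0,011,012,013,0(-1)(-1),0(-1)(-2),0(-1)(-3)$; - $t^{-1}a^ita^jta^k$ and $t^{-2}a^ita^jta^k$, $ijk=(\pm1)0(\pm1),(\pm1)0(\pm2),(\pm1)0(\pm3)$. (5) (types $PX$, $NPX$; positive $t$-exponent) Words $t^{-k}a^{\epsilon_0}ta^{\epsilon_1}t\cdots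 a^{\epsilon_{l-1}}ta^{\epsilon_l}t^{-m}$ with $k\ge0$, $m>0$, $k+m<l$, and $\epsilon_0\neq0$ if $k>0$. If $l\ge3$: the $P$-run ends with one of $002,102,012,003,103,(-1)03,013$ or the negative of one of these; all earlier entries are in $\{0,1,-1\}$; and no two consecutive entries are both nonzero, except possibly within the three-entry suffix. If $l=2$: the word is in $L_4$, the set of words - $a^ita^jta^kt^{-1}$, $ijk=00(\pm2),00(\pm3),012,013,0(-1)(-2),0(-1)(-3),102,10(\pm3),(-1)0(-2),(-1)0(\pm3)$.
   Formalization: The 24 words of L_2 in which t^{-1} is directly followed by a^{±2} or a^{±3} (entries 0(±2), 0(±3), 0(±2)0, 0(±3)0, 00(±2), 00(±3)) are excluded: they lie in NF as defined but are not geodesic, since t^{-1}a^2 = a t^{-1}. *)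

theory Defs
  imports "HOL-Algebra.Group"
begin

(* LA, LAi, LT, LTi stand for a, a^-1, t, t^-1. *)
datatype letter = LA | LAi | LT | LTi

type_synonym word = "letter list"

fun inv_letter :: "letter \<Rightarrow> letter" where
  "inv_letter LA = LAi"
| "inv_letter LAi = LA"
| "inv_letter LT = LTi"
| "inv_letter LTi = LT"

(* The least congruence on words generated by free cancellation and the defining
   relation t a t^-1 = a^2; its quotient is the group given by the presentation. *)
inductive bs_eq :: "word \<Rightarrow> word \<Rightarrow> bool" where
  bs_refl: "bs_eq u u"
| bs_sym: "bs_eq u v \<Longrightarrow> bs_eq v u"
| bs_trans: "bs_eq u v \<Longrightarrow> bs_eq v w \<Longrightarrow> bs_eq u w"
| bs_cong: "bs_eq u v \<Longrightarrow> bs_eq (x @ u @ y) (x @ v @ y)"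
| bs_cancel: "bs_eq [x, inv_letter x] []"
| bs_rel: "bs_eq [LT, LA, LTi] [LA, LA]"

definition bs_elem :: "word \<Rightarrow> word set" where
  "bs_elem w = {v. bs_eq w v}"

definition BS12 :: "word set monoid" where
  "BS12 = \<lparr>carrier = range bs_elem,
           mult = (\<lambda>X Y. \<Union>u\<in>X. \<Union>v\<in>Y. bs_elem (u @ v)),
           one = bs_elem []\<rparr>"

lemma bs_elem_eq_iff: "bs_elem u = bs_elem v \<longleftrightarrow> bs_eq u v"
proof
  assume "bs_elem u = bs_elem v"
  then have "v \<in> bs_elem u"
    by (simp add: bs_elem_def bs_refl)
  then show "bs_eq u v"
    by (simp add: bs_elem_def)
next
  assume "bs_eq u v"
  then show "bs_elem u = bs_elem v"
    unfolding bs_elem_def using bs_trans[of u v] bs_trans[OF bs_sym, of u v] by blast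
qed

lemma bs_eq_append:
  assumes "bs_eq u u'" "bs_eq v v'"
  shows "bs_eq (u @ v) (u' @ v')"
  using bs_trans[OF bs_cong[OF assms(1), of "[]" v], of "u' @ v'"]
    bs_cong[OF assms(2), of u' "[]"]
  by simp

lemma bs_elem_append: "bs_elem (u @ v) = bs_elem u \<otimes>\<^bsub>BS12\<^esub> bs_elem v"
proof -
  have "bs_elem (u' @ v') = bs_elem (u @ v)" if "u' \<in> bs_elem u" "v' \<in> bs_elem v" for u' v'
    using that unfolding bs_elem_eq_iff by (simp add: bs_elem_def bs_eq_append bs_sym)
  moreover have "u \<in> bs_elem u" "v \<in> bs_elem v"
    by (simp_all add: bs_elem_def bs_refl)
  ultimately have "bs_elem (u @ v) = (\<Union>u'\<in>bs_elem u. \<Union>v'\<in>bs_elem v. bs_elem (u' @ v'))"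
    by blast
  then show ?thesis
    by (simp add: BS12_def)
qed

lemma bs_inverse: "bs_eq (map inv_letter (rev w) @ w) []"
proof (induction w)
  case (Cons x w)
  have "bs_eq [inv_letter x, x] []"
    using bs_cancel[of "inv_letter x"] by (cases x) auto
  from bs_trans[OF bs_cong[OF this, of "map inv_letter (rev w)" w], of "[]"] Cons show ?case
    by simp
qed (simp add: bs_refl)

lemma group_BS12: "group BS12"
proof (rule groupI)
  show "\<one>\<^bsub>BS12\<^esub> \<in> carrier BS12"
    by (simp add: BS12_def)
next
  fix X Y assume "X \<in> carrier BS12" "Y \<in> carrier BS12"
  then obtain u v where "X = bs_elem u" "Y = bs_elem v"
    by (auto simp: BS12_def)
  then have "X \<otimes>\<^bsub>BS12\<^esub> Y = bs_elem (u @ v)"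
    by (simp add: bs_elem_append)
  then show "X \<otimes>\<^bsub>BS12\<^esub> Y \<in> carrier BS12"
    by (simp add: BS12_def)
next
  fix X Y Z assume "X \<in> carrier BS12" "Y \<in> carrier BS12" "Z \<in> carrier BS12"
  then obtain u v w where "X = bs_elem u" "Y = bs_elem v" "Z = bs_elem w"
    by (auto simp: BS12_def)
  then show "X \<otimes>\<^bsub>BS12\<^esub> Y \<otimes>\<^bsub>BS12\<^esub> Z = X \<otimes>\<^bsub>BS12\<^esub> (Y \<otimes>\<^bsub>BS12\<^esub> Z)"
    by (simp flip: bs_elem_append)
next
  fix X assume "X \<in> carrier BS12"
  then obtain u where u: "X = bs_elem u"
    by (auto simp: BS12_def)
  have one: "\<one>\<^bsub>BS12\<^esub> = bs_elem []"
    by (simp add: BS12_def)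
  show "\<one>\<^bsub>BS12\<^esub> \<otimes>\<^bsub>BS12\<^esub> X = X"
    by (simp add: u one flip: bs_elem_append)
  have "bs_elem (map inv_letter (rev u)) \<otimes>\<^bsub>BS12\<^esub> X = \<one>\<^bsub>BS12\<^esub>"
    by (simp add: u one bs_elem_eq_iff bs_inverse flip: bs_elem_append)
  moreover have "bs_elem (map inv_letter (rev u)) \<in> carrier BS12"
    by (simp add: BS12_def)
  ultimately show "\<exists>Y\<in>carrier BS12. Y \<otimes>\<^bsub>BS12\<^esub> X = \<one>\<^bsub>BS12\<^esub>"
    by blast
qed

definition geodesic :: "word \<Rightarrow> bool" where
  "geodesic w \<longleftrightarrow> (\<forall>v. bs_elem v = bs_elem w \<longrightarrow> length w \<le> length v)"

fun a_pow :: "int \<Rightarrow> word" where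
  "a_pow i = (if 0 \<le> i then replicate (nat i) LA else replicate (nat (- i)) LAi)"

(* Entry sequences are listed in the order in which they occur in the word, so the list
   for an N-run is [eps_l, ..., eps_0] and the list for a P-run is [eps_0, ..., eps_l]. *)
fun run :: "letter \<Rightarrow> int list \<Rightarrow> word" where
  "run x [] = []"
| "run x [e] = a_pow e"
| "run x (e # f # es) = a_pow e @ x # run x (f # es)"

abbreviation n_run :: "int list \<Rightarrow> word" where "n_run \<equiv> run LTi"
abbreviation p_run :: "int list \<Rightarrow> word" where "p_run \<equiv> run LT"

definition with_neg :: "int list set \<Rightarrow> int list set" where
  "with_neg S = S \<union> map uminus ` S"

(* The sets S below consist of lists of length 3. *)
definition n_long :: "int list set \<Rightarrow> int list \<Rightarrow> bool" where
  "n_long S es \<longleftrightarrow>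
     (\<exists>p \<in> with_neg S. \<exists>r. es = p @ r \<and> set r \<subseteq> {0, 1, -1}) \<and>
     (\<forall>i. i + 1 < length es \<longrightarrow> es ! i \<noteq> 0 \<longrightarrow> es ! (i + 1) \<noteq> 0 \<longrightarrow> i + 1 < 3)"

definition p_long :: "int list set \<Rightarrow> int list \<Rightarrow> bool" where
  "p_long S es \<longleftrightarrow>
     (\<exists>s \<in> with_neg S. \<exists>r. es = r @ s \<and> set r \<subseteq> {0, 1, -1}) \<and>
     (\<forall>i. i + 1 < length es \<longrightarrow> es ! i \<noteq> 0 \<longrightarrow> es ! (i + 1) \<noteq> 0 \<longrightarrow> length es \<le> i + 3)"

definition pre_X :: "int list set" where
  "pre_X =
     {[2,0,0], [2,0,1], [2,1,0], [3,0,0], [3,0,1], [3,0,-1], [3,1,0]}"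

definition pre_N :: "int list set" where
  "pre_N =
     {[0,0,0], [0,0,1], [0,1,0], [1,0,0], [1,0,1], [1,0,-1], [1,1,0], [2,0,0], [2,0,1],
      [2,0,-1], [2,1,0], [3,0,0], [3,0,1], [3,0,-1], [3,1,0]}"

definition suf_P :: "int list set" where
  "suf_P =
     {[0,0,0], [1,0,0], [0,1,0], [0,0,1], [1,0,1], [-1,0,1], [0,1,1], [0,0,2], [1,0,2],
      [-1,0,2], [0,1,2], [0,0,3], [1,0,3], [-1,0,3], [0,1,3]}"

definition suf_PX :: "int list set" where
  "suf_PX =
     {[0,0,2], [1,0,2], [0,1,2], [0,0,3], [1,0,3], [-1,0,3], [0,1,3]}"

definition L1 :: "word set" where
  "L1 =
    (\<lambda>es. [LT] @ n_run es) `
      {[2,0], [-2,0], [3,0], [-3,0], [2,1], [3,1], [-2,-1], [-3,-1]} \<union>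
    (\<lambda>es. [LT] @ n_run es) `
      {[2,0,0], [-2,0,0], [3,0,0], [-3,0,0], [2,0,1], [3,0,1], [-3,0,1], [-2,0,-1],
       [3,0,-1], [-3,0,-1], [2,1,0], [3,1,0], [-2,-1,0], [-3,-1,0]} \<union>
    (\<lambda>es. [LT, LT] @ n_run es) `
      {[2,0,0], [-2,0,0], [3,0,0], [-3,0,0], [2,0,1], [3,0,1], [-3,0,1], [-2,0,-1],
       [3,0,-1], [-3,0,-1], [2,1,0], [3,1,0], [-2,-1,0], [-3,-1,0]} \<union>
    (\<lambda>es. [LT] @ n_run es @ [LT]) `
      {[2,0,1], [3,0,1], [-3,0,1], [-2,0,-1], [3,0,-1], [-3,0,-1]}"

definition L2 :: "word set" where
  "L2 =
    (\<lambda>es. n_run es) `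
      {[0,0], [1,0], [-1,0], [2,0], [-2,0], [3,0], [-3,0], [0,1], [0,-1], [0,2], [0,-2],
       [0,3], [0,-3], [1,1], [2,1], [3,1], [-1,-1], [-2,-1], [-3,-1]} \<union>
    (\<lambda>es. n_run es @ [LT]) `
      {[0,1], [0,-1], [0,2], [0,-2], [0,3], [0,-3], [1,1], [2,1], [3,1], [-1,-1], [-2,-1],
       [-3,-1]} \<union>
    (\<lambda>es. n_run es) `
      {[0,0,0], [1,0,0], [-1,0,0], [2,0,0], [-2,0,0], [3,0,0], [-3,0,0], [0,1,0], [0,-1,0],
       [0,2,0], [0,-2,0], [0,3,0], [0,-3,0], [0,0,1], [0,0,-1], [0,0,2], [0,0,-2], [0,0,3],
       [0,0,-3], [1,0,1], [1,0,-1], [-1,0,1], [-1,0,-1], [2,0,1], [2,0,-1], [-2,0,1],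
       [-2,0,-1], [3,0,1], [3,0,-1], [-3,0,1], [-3,0,-1], [1,1,0], [2,1,0], [3,1,0],
       [-1,-1,0], [-2,-1,0], [-3,-1,0]} \<union>
    (\<lambda>es. n_run es @ [LT]) `
      {[0,0,1], [0,0,-1], [0,0,2], [0,0,-2], [0,0,3], [0,0,-3], [1,0,1], [1,0,-1],
       [-1,0,1], [-1,0,-1], [2,0,1], [2,0,-1], [-2,0,1], [-2,0,-1], [3,0,1], [3,0,-1],
       [-3,0,1], [-3,0,-1]} \<union>
    (\<lambda>es. n_run es @ [LT, LT]) `
      {[0,0,1], [0,0,-1], [0,0,2], [0,0,-2], [0,0,3], [0,0,-3], [1,0,1], [1,0,-1],
       [-1,0,1], [-1,0,-1], [2,0,1], [2,0,-1], [-2,0,1], [-2,0,-1], [3,0,1], [3,0,-1],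
       [-3,0,1], [-3,0,-1]}"

definition L3 :: "word set" where
  "L3 =
    (\<lambda>es. p_run es) `
      {[0,0], [0,1], [0,-1], [0,2], [0,-2], [0,3], [0,-3], [1,0], [-1,0], [1,1], [1,2],
       [1,3], [-1,-1], [-1,-2], [-1,-3]} \<union>
    (\<lambda>es. [LTi] @ p_run es) `
      {[1,0], [-1,0], [1,1], [1,2], [1,3], [-1,-1], [-1,-2], [-1,-3]} \<union>
    (\<lambda>es. p_run es) `
      {[0,0,0], [0,0,1], [0,0,-1], [0,0,2], [0,0,-2], [0,0,3], [0,0,-3], [1,0,1], [1,0,-1],
       [-1,0,1], [-1,0,-1], [1,0,2], [1,0,-2], [-1,0,2], [-1,0,-2], [1,0,3], [1,0,-3],
       [-1,0,3], [-1,0,-3], [0,1,0], [0,-1,0], [0,1,1], [0,1,2], [0,1,3], [0,-1,-1],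
       [0,-1,-2], [0,-1,-3]} \<union>
    (\<lambda>es. [LTi] @ p_run es) `
      {[1,0,1], [1,0,-1], [-1,0,1], [-1,0,-1], [1,0,2], [1,0,-2], [-1,0,2], [-1,0,-2],
       [1,0,3], [1,0,-3], [-1,0,3], [-1,0,-3]} \<union>
    (\<lambda>es. [LTi, LTi] @ p_run es) `
      {[1,0,1], [1,0,-1], [-1,0,1], [-1,0,-1], [1,0,2], [1,0,-2], [-1,0,2], [-1,0,-2],
       [1,0,3], [1,0,-3], [-1,0,3], [-1,0,-3]}"

definition L4 :: "word set" where
  "L4 =
    (\<lambda>es. p_run es @ [LTi]) `
      {[0,0,2], [0,0,-2], [0,0,3], [0,0,-3], [0,1,2], [0,1,3], [0,-1,-2], [0,-1,-3],
       [1,0,2], [1,0,3], [1,0,-3], [-1,0,-2], [-1,0,3], [-1,0,-3]}"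

definition NF1 :: "word set" where
  "NF1 = a_pow ` {0, 1, -1, 2, -2, 3, -3}"

definition NF2 :: "word set" where
  "NF2 = {w. \<exists>k m l es.
     w = replicate k LT @ n_run es @ replicate m LT \<and> length es = l + 1 \<and>
     k > 0 \<and> l \<ge> k + m \<and> (m > 0 \<longrightarrow> last es \<noteq> 0) \<and>
     (if l \<ge> 3 then n_long pre_X es else w \<in> L1)}"

definition NF3 :: "word set" where
  "NF3 = {w. \<exists>k l es.
     w = n_run es @ replicate k LT \<and> length es = l + 1 \<and>
     k <= l \<and> (k > 0 \<longrightarrow> last es \<noteq> 0) \<and>
     (if l \<ge> 3 then n_long pre_N es else w \<in> L2)}"

definition NF4 :: "word set" where
  "NF4 = {w. \<exists>k l es.
     w = replicate k LTi @ p_run es \<and> length es = l + 1 \<and>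
     k < l \<and> (k > 0 \<longrightarrow> hd es \<noteq> 0) \<and>
     (if l \<ge> 3 then p_long suf_P es else w \<in> L3)}"

definition NF5 :: "word set" where
  "NF5 = {w. \<exists>k m l es.
     w = replicate k LTi @ p_run es @ replicate m LTi \<and> length es = l + 1 \<and>
     m > 0 \<and> k + m < l \<and> (k > 0 \<longrightarrow> hd es \<noteq> 0) \<and>
     (if l \<ge> 3 then p_long suf_PX es else w \<in> L4)}"

definition NF :: "word set" where
  "NF = NF1 \<union> NF2 \<union> NF3 \<union> NF4 \<union> NF5"

(* Pitfall: NF is the language exactly as published, and it contains words that are not
   geodesic, namely the words in L2 in which a power a^i with 2 <= |i| is preceded by t^-1
   (t^-1 a^2 = a t^-1). These 24 words are collected here; see nongeodesic_L2. *)
definition L2_nongeodesic :: "word set" where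
  "L2_nongeodesic =
    (\<lambda>es. n_run es) `
      {[0,2], [0,-2], [0,3], [0,-3]} \<union>
    (\<lambda>es. n_run es @ [LT]) `
      {[0,2], [0,-2], [0,3], [0,-3]} \<union>
    (\<lambda>es. n_run es) `
      {[0,2,0], [0,-2,0], [0,3,0], [0,-3,0], [0,0,2], [0,0,-2], [0,0,3], [0,0,-3]} \<union>
    (\<lambda>es. n_run es @ [LT]) `
      {[0,0,2], [0,0,-2], [0,0,3], [0,0,-3]} \<union>
    (\<lambda>es. n_run es @ [LT, LT]) `
      {[0,0,2], [0,0,-2], [0,0,3], [0,0,-3]}"

lemma LTi_LA_LA: "x \<in> {LA, LAi} \<Longrightarrow> bs_eq [LTi, x, x] [x, LTi]"
proof -
  have c: "bs_eq [LTi, LT] []" "bs_eq [LA, LAi] []" "bs_eq [LAi, LA] []"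
    using bs_cancel[of LTi] bs_cancel[of LA] bs_cancel[of LAi] by auto
  have pos: "bs_eq [LTi, LA, LA] [LA, LTi]"
    using bs_trans[OF bs_cong[OF bs_sym[OF bs_rel], of "[LTi]" "[]"], of "[LA, LTi]"]
      bs_cong[OF c(1), of "[]" "[LA, LTi]"] by simp
  have 1: "bs_eq [LAi, LA, LTi, LAi, LAi] [LTi, LAi, LAi]"
    using bs_cong[OF c(3), of "[]" "[LTi, LAi, LAi]"] by simp
  have 2: "bs_eq [LAi, LTi, LA, LA, LAi, LAi] [LAi, LA, LTi, LAi, LAi]"
    using bs_cong[OF pos, of "[LAi]" "[LAi, LAi]"] by simp
  have 3: "bs_eq [LAi, LTi, LA, LA, LAi, LAi] [LAi, LTi, LA, LAi]"
    using bs_cong[OF c(2), of "[LAi, LTi, LA]" "[LAi]"] by simp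
  have 4: "bs_eq [LAi, LTi, LA, LAi] [LAi, LTi]"
    using bs_cong[OF c(2), of "[LAi, LTi]" "[]"] by simp
  have "bs_eq [LTi, LAi, LAi] [LAi, LTi]"
    by (rule bs_trans[OF bs_sym[OF 1] bs_trans[OF bs_sym[OF 2] bs_trans[OF 3 4]]])
  with pos show "x \<in> {LA, LAi} \<Longrightarrow> bs_eq [LTi, x, x] [x, LTi]"
    by auto
qed

lemma nongeodesicI:
  assumes "x \<in> {LA, LAi}" "w = u @ [LTi, x, x] @ v"
  shows "\<not> geodesic w"
proof -
  have "bs_elem (u @ [x, LTi] @ v) = bs_elem w"
    using bs_cong[OF LTi_LA_LA[OF assms(1)], of u v] assms(2)
    unfolding bs_elem_eq_iff by (simp add: bs_sym)
  moreover have "length (u @ [x, LTi] @ v) < length w"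
    using assms(2) by simp
  ultimately show ?thesis
    unfolding geodesic_def by (meson not_less)
qed

lemma L2_nongeodesic_subset: "L2_nongeodesic \<subseteq> L2"
  unfolding L2_nongeodesic_def L2_def
  apply (intro Un_least)
  subgoal by (rule le_supI1, rule le_supI1, rule le_supI1, rule le_supI1, rule image_mono, simp)
  subgoal by (rule le_supI1, rule le_supI1, rule le_supI1, rule le_supI2, rule image_mono, simp)
  subgoal by (rule le_supI1, rule le_supI1, rule le_supI2, rule image_mono, simp)
  subgoal by (rule le_supI1, rule le_supI2, rule image_mono, simp)
  subgoal by (rule le_supI2, rule image_mono, simp)
  done

lemma NF3_shortI:
  assumes "w \<in> L2" "w = n_run es @ replicate k LT" "length es = l + 1" "k \<le> l" "l \<le> 2"
    "last es \<noteq> 0 \<or> k = 0"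
  shows "w \<in> NF3"
  unfolding NF3_def mem_Collect_eq
  by (rule exI[of _ k], rule exI[of _ l], rule exI[of _ es]) (use assms in auto)

lemma nongeodesic_L2:
  assumes "w \<in> L2_nongeodesic"
  shows "w \<in> NF" and "\<not> geodesic w"
proof -
  have L2: "w \<in> L2"
    using assms L2_nongeodesic_subset by blast
  have "w \<in> NF3"
    using assms unfolding L2_nongeodesic_def
    apply (elim UnE imageE)
    subgoal for es by (rule NF3_shortI[OF L2, of es 0 1]) auto
    subgoal for es by (rule NF3_shortI[OF L2, of es 1 1]) auto
    subgoal for es by (rule NF3_shortI[OF L2, of es 0 2]) auto
    subgoal for es by (rule NF3_shortI[OF L2, of es 1 2]) auto
    subgoal for es by (rule NF3_shortI[OF L2, of es 2 2]) (auto simp: numeral_2_eq_2)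
    done
  then show "w \<in> NF"
    unfolding NF_def by blast
  have "\<exists>v. w = LTi # LA # LA # v \<or> w = LTi # LAi # LAi # v \<or>
      w = LTi # LTi # LA # LA # v \<or> w = LTi # LTi # LAi # LAi # v"
    using assms unfolding L2_nongeodesic_def
    apply (elim UnE imageE)
    by (elim insertE emptyE; simp add: eval_nat_numeral)+
  then show "\<not> geodesic w"
    using nongeodesicI[of LA w "[]"] nongeodesicI[of LAi w "[]"]
      nongeodesicI[of LA w "[LTi]"] nongeodesicI[of LAi w "[LTi]"]
    by auto
qed

end

theory Submission
  imports Defs Complex_Main
begin

text \<open>
  A word is a walk on the integer heights: \<open>t\<close> and its inverse go up and down, and
  \<open>a\<close> read at height \<open>i\<close> adds \<open>2 ^ i\<close> to a dyadic number \<open>x\<close>. The group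
  element determines \<open>x\<close> and the final height \<open>s\<close>. If the walk stays between
  \<open>-p\<close> and \<open>q\<close> and has net exponent \<open>e i\<close> at height \<open>i - p\<close>, then the
  integer \<open>n = 2 ^ p * x\<close> is \<open>\<Sum>i\<le>p + q. e i * 2 ^ i\<close>, and the length of the word is
  at least \<open>(\<Sum>i. \<bar>e i\<bar>) + 2 * (p + q) - \<bar>s\<bar>\<close>. Hence the length problem in the group
  is the problem of minimising, over the number \<open>L\<close> of the top digit position, the least
  digit sum of \<open>n\<close> on the positions \<open>0..L\<close> plus \<open>2 * L\<close>
  (\<open>length_lower_bound\<close>, \<open>geodesicI\<close>). The depth \<open>p\<close> is no real choice: digits
  below the necessary depth can be carried upwards for free, and the normal forms considered here go
  below both \<open>0\<close> and \<open>s\<close> only when their lowest digit is odd.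

  Opening one more position costs \<open>2\<close>. It saves at most \<open>2\<close> in digits as long as
  \<open>\<bar>n\<bar> \<le> 5 * 2 ^ L\<close> (\<open>digit_cost_extra_level\<close>), and it saves at least
  \<open>2\<close> as soon as \<open>4 * 2 ^ L \<le> \<bar>n\<bar>\<close> (\<open>digit_cost_missing_level\<close>). In
  these normal forms the leading digit has absolute value at most \<open>3\<close> and all others at most
  \<open>1\<close>, which keeps \<open>n\<close> in the first range.
  A walk that rises above both \<open>0\<close> and \<open>s\<close> could also have used fewer positions;
  in the families where this happens the leading digit is \<open>\<plusminus>2\<close> or \<open>\<plusminus>3\<close>
  followed by digits that make the last position worth its price.

  That the digits of a normal form have the least sum for their number of positions is a matter of
  non-adjacency: an odd digit \<open>\<plusminus>1\<close> in front of an even number is forced to cost exactly one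
  (\<open>digit_cost_odd_step\<close>). So sequences are built up from their three leading digits by
  prepending low digits (\<open>sparse_digits\<close>), and only the leading triples and the words with at
  most three digits remain to be computed.
\<close>

section \<open>The cost of writing an integer with boundedly many digits\<close>

text \<open>
  The least value of \<open>\<Sum>i\<le>L. \<bar>e i\<bar>\<close> over all integer digits with
  \<open>n = (\<Sum>i\<le>L. e i * 2 ^ i)\<close>. Below the top position the digits can be restricted to
  \<open>0\<close>, \<open>1\<close> and \<open>-1\<close>, because replacing a digit \<open>\<plusminus>2\<close> by a carry
  \<open>\<plusminus>1\<close> never increases the sum.
\<close>

fun digit_cost :: "nat \<Rightarrow> int \<Rightarrow> int" where
  "digit_cost 0 n = \<bar>n\<bar>"
| "digit_cost (Suc L) n =
     (if even n then digit_cost L (n div 2)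
      else 1 + min (digit_cost L (n div 2)) (digit_cost L (n div 2 + 1)))"

lemma digit_cost_double: "digit_cost (Suc L) (2 * m) = digit_cost L m"
  by simp

lemma digit_cost_double_plus_1:
  "digit_cost (Suc L) (2 * m + 1) = 1 + min (digit_cost L m) (digit_cost L (m + 1))"
  by simp

lemmas digit_cost_Suc = digit_cost_double digit_cost_double_plus_1

declare digit_cost.simps(2) [simp del]

lemma int_parity_cases:
  fixes n :: int
  obtains m where "n = 2 * m" | m where "n = 2 * m + 1"
  by (meson evenE oddE)

text \<open>
  Every expansion of \<open>n\<close> becomes one of \<open>n + 2 ^ j\<close> by changing one digit by one, and
  conversely. This is how a single letter \<open>a\<close> or its inverse affects the cost.
\<close>

lemma digit_cost_add_power:
  "j \<le> L \<Longrightarrow> \<bar>digit_cost L (n + 2 ^ j) - digit_cost L n\<bar> \<le> 1"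
proof (induction L arbitrary: n j)
  case 0
  then show ?case by simp
next
  case (Suc L)
  show ?case
  proof (cases j)
    case 0
    show ?thesis
    proof (cases n rule: int_parity_cases)
      case (1 m)
      have "\<bar>digit_cost L (m + 1) - digit_cost L m\<bar> \<le> 1"
        using Suc.IH[of 0 m] by simp
      then show ?thesis
        using 0 1 by (simp add: digit_cost_Suc)
    next
      case (2 m)
      have "\<bar>digit_cost L (m + 1) - digit_cost L m\<bar> \<le> 1"
        using Suc.IH[of 0 m] by simp
      moreover have "n + 2 ^ j = 2 * (m + 1)"
        using 0 2 by simp
      ultimately show ?thesis
        unfolding 2 by (simp only: digit_cost_Suc)
    qed
  next
    case (Suc i)
    then have i: "i \<le> L" using Suc.prems by simp
    show ?thesis
    proof (cases n rule: int_parity_cases)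
      case (1 m)
      have "n + 2 ^ j = 2 * (m + 2 ^ i)"
        using Suc 1 by simp
      then show ?thesis
        unfolding 1 using Suc.IH[OF i, of m] by (simp only: digit_cost_Suc)
    next
      case (2 m)
      have "n + 2 ^ j = 2 * (m + 2 ^ i) + 1"
        using Suc 2 by simp
      then show ?thesis
        unfolding 2 using Suc.IH[OF i, of m] Suc.IH[OF i, of "m + 1"]
        by (simp only: digit_cost_Suc) (simp add: algebra_simps)
    qed
  qed
qed

lemma digit_cost_add_1: "\<bar>digit_cost L (n + 1) - digit_cost L n\<bar> \<le> 1"
  using digit_cost_add_power[of 0 L n] by simp

lemma digit_cost_diff_power:
  "j \<le> L \<Longrightarrow> digit_cost L (n - 2 ^ j) \<le> digit_cost L n + 1"
  using digit_cost_add_power[of j L "n - 2 ^ j"] by simp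

lemma digit_cost_Suc_le: "digit_cost (Suc L) n \<le> digit_cost L n"
proof (induction L arbitrary: n)
  case 0
  show ?case
    by (cases n rule: int_parity_cases) (auto simp: digit_cost_Suc)
next
  case (Suc L)
  show ?case
  proof (cases n rule: int_parity_cases)
    case (1 m)
    then show ?thesis using Suc.IH[of m] by (simp only: digit_cost_Suc)
  next
    case (2 m)
    then show ?thesis using Suc.IH[of m] Suc.IH[of "m + 1"]
      by (simp only: digit_cost_Suc)
  qed
qed

lemma digit_cost_mult_power: "digit_cost (L + j) (n * 2 ^ j) = digit_cost L n"
proof (induction j)
  case (Suc j)
  have "n * 2 ^ Suc j = 2 * (n * 2 ^ j)" by simp
  then show ?case using Suc by (simp only: digit_cost_Suc add_Suc_right)
qed simp

text \<open>
  The non-adjacency step. With \<open>m = 2 * r\<close>, the only alternative to the low digit \<open>d\<close>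
  is \<open>-d\<close>, which leaves the odd neighbour \<open>m + d\<close>; this has to spend another digit to
  reach \<open>r\<close> or \<open>r + d\<close>, and by \<open>digit_cost_add_1\<close> that does not pay. If the
  neighbour is read on a single position (\<open>L = 0\<close>), the step fails: \<open>3\<close> costs three as
  \<open>-1 + 2 * 2\<close>, but two as \<open>1 + 2 * 1\<close>.
\<close>

lemma digit_cost_odd_step:
  assumes "even m" "1 \<le> L" "d = 1 \<or> d = -1"
  shows "digit_cost (Suc L) (d + 2 * m) = 1 + digit_cost L m"
proof -
  obtain r where m: "m = 2 * r" using assms(1) by blast
  obtain K where L: "L = Suc K" using assms(2) by (cases L) auto
  from assms(3) show ?thesis
  proof
    assume "d = 1"
    then have *: "d + 2 * m = 2 * (2 * r) + 1" by (simp add: m)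
    show ?thesis
      unfolding * using digit_cost_add_1[of K r] by (simp only: L m digit_cost_Suc)
  next
    assume "d = -1"
    then have *: "d + 2 * m = 2 * (2 * (r - 1) + 1) + 1" by (simp add: m)
    have **: "2 * (r - 1) + 1 + 1 = 2 * r" by simp
    show ?thesis
      unfolding * using digit_cost_add_1[of K "r - 1"]
      by (simp only: L m digit_cost_Suc **) simp
  qed
qed

text \<open>
  The factor \<open>5\<close> is sharp: \<open>6 = 0 + 2 * 3\<close> costs \<open>6\<close> on one position and
  \<open>3\<close> on two. The bound passes through halving because both \<open>m\<close> and \<open>m + 1\<close>
  inherit it from the odd number \<open>2 * m + 1\<close>.
\<close>

lemma digit_cost_extra_level:
  "\<bar>n\<bar> \<le> 5 * 2 ^ L \<Longrightarrow> digit_cost L n \<le> digit_cost (Suc L) n + 2"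
proof (induction L arbitrary: n)
  case 0
  then show ?case
    by (cases n rule: int_parity_cases) (auto simp: digit_cost_Suc)
next
  case (Suc L)
  show ?case
  proof (cases n rule: int_parity_cases)
    case (1 m)
    then show ?thesis using Suc.IH[of m] Suc.prems by (simp add: digit_cost_Suc)
  next
    case (2 m)
    have "\<bar>m\<bar> \<le> 5 * 2 ^ L" "\<bar>m + 1\<bar> \<le> 5 * 2 ^ L"
      using Suc.prems 2 by (auto simp: abs_if split: if_splits)
    from this[THEN Suc.IH] show ?thesis
      unfolding 2 by (simp only: digit_cost_Suc)
  qed
qed

lemma digit_cost_more_levels:
  assumes "\<bar>n\<bar> \<le> 5 * 2 ^ L"
  shows "digit_cost L n \<le> digit_cost (L + j) n + 2 * int j"
proof (induction j)
  case (Suc j)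
  have "(2::int) ^ L \<le> 2 ^ (L + j)" by simp
  then have "\<bar>n\<bar> \<le> 5 * 2 ^ (L + j)" using assms by linarith
  from digit_cost_extra_level[OF this] Suc show ?case by simp
qed simp

text \<open>
  The converse estimate: above low digits \<open>0\<close> and \<open>\<plusminus>1\<close>, a number this large has a top
  digit of absolute value at least
  \<open>4\<close>, and moving that digit up one position halves it, up to a remainder of one.
\<close>

lemma digit_cost_missing_level:
  "4 * 2 ^ L \<le> \<bar>n\<bar> \<Longrightarrow> digit_cost (Suc L) n + 2 \<le> digit_cost L n"
proof (induction L arbitrary: n)
  case 0
  then show ?case
    by (cases n rule: int_parity_cases) (auto simp: digit_cost_Suc)
next
  case (Suc L)
  show ?case
  proof (cases n rule: int_parity_cases)
    case (1 m)
    then show ?thesis using Suc.IH[of m] Suc.prems by (simp add: digit_cost_Suc)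
  next
    case (2 m)
    have "4 * 2 ^ L \<le> \<bar>m\<bar>" "4 * 2 ^ L \<le> \<bar>m + 1\<bar>"
      using Suc.prems 2 by (auto simp: abs_if split: if_splits)
    from this[THEN Suc.IH] show ?thesis
      unfolding 2 by (simp only: digit_cost_Suc)
  qed
qed

lemma digit_cost_fewer_levels:
  "4 * 2 ^ (L + j) \<le> 2 * \<bar>n\<bar> \<Longrightarrow> digit_cost (L + j) n + 2 * int j \<le> digit_cost L n"
proof (induction j)
  case (Suc j)
  have "0 < (2::int) ^ (L + j)" by simp
  then have "digit_cost (L + j) n + 2 * int j \<le> digit_cost L n"
    using Suc.IH Suc.prems by simp
  then show ?case
    using digit_cost_missing_level[of "L + j" n] Suc.prems by simp
qed simp

section \<open>A lower bound for the length of every word of an element\<close>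

text \<open>
  The generators act on the line as \<open>z \<mapsto> z + 1\<close> and \<open>z \<mapsto> 2 * z\<close>, with the
  leftmost letter applied last. The image of \<open>0\<close> together with the height are the two
  coordinates of an element in the semidirect product of the dyadic numbers with the integers.
\<close>

fun letter_map :: "letter \<Rightarrow> real \<Rightarrow> real" where
  "letter_map LA z = z + 1"
| "letter_map LAi z = z - 1"
| "letter_map LT z = 2 * z"
| "letter_map LTi z = z / 2"

fun letter_height :: "letter \<Rightarrow> int" where
  "letter_height LA = 0"
| "letter_height LAi = 0"
| "letter_height LT = 1"
| "letter_height LTi = -1"

definition act :: "word \<Rightarrow> real \<Rightarrow> real" where
  "act w z = foldr letter_map w z"

definition height :: "word \<Rightarrow> int" where
  "height w = sum_list (map letter_height w)"

lemma act_simps [simp]: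
  "act [] z = z" "act (x # w) z = letter_map x (act w z)" "act (u @ v) z = act u (act v z)"
  by (simp_all add: act_def)

lemma height_simps [simp]:
  "height [] = 0" "height (x # w) = letter_height x + height w"
  "height (u @ v) = height u + height v"
  by (simp_all add: height_def)

lemma bs_eq_act: "bs_eq u v \<Longrightarrow> act u z = act v z"
proof (induction arbitrary: z rule: bs_eq.induct)
  case (bs_cancel x)
  show ?case by (cases x) auto
qed auto

lemma bs_eq_height: "bs_eq u v \<Longrightarrow> height u = height v"
proof (induction rule: bs_eq.induct)
  case (bs_cancel x)
  show ?case by (cases x) auto
qed auto

text \<open>
  Letters are put in front, so a vertical letter shifts the whole range \<open>-p..q\<close> of visited
  heights by one; the range grows only if \<open>0\<close> would otherwise fall outside. In that case
  \<open>s\<close> moves away from \<open>0\<close>, and \<open>\<bar>s\<bar>\<close> pays for one of the two units by which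
  \<open>2 * (p + q)\<close> increases.
\<close>

lemma length_lower_bound:
  "\<exists>n p q. act v 0 = of_int n / 2 ^ p \<and> - int p \<le> height v \<and> height v \<le> int q \<and>
     digit_cost (p + q) n + 2 * int (p + q) \<le> int (length v) + \<bar>height v\<bar>"
proof (induction v)
  case Nil
  show ?case by (rule exI[of _ 0], rule exI[of _ 0], rule exI[of _ 0]) simp
next
  case (Cons x w)
  then obtain n p q where act: "act w 0 = of_int n / 2 ^ p"
    and h: "- int p \<le> height w" "height w \<le> int q"
    and len: "digit_cost (p + q) n + 2 * int (p + q) \<le> int (length w) + \<bar>height w\<bar>"
    by blast
  show ?case
  proof (cases x)
    case LA
    have "digit_cost (p + q) (n + 2 ^ p) \<le> digit_cost (p + q) n + 1"
      using digit_cost_add_power[of p "p + q" n] by simp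
    then show ?thesis
      using act h len LA
      by (intro exI[of _ "n + 2 ^ p"] exI[of _ p] exI[of _ q]) (simp add: field_simps)
  next
    case LAi
    have "digit_cost (p + q) (n - 2 ^ p) \<le> digit_cost (p + q) n + 1"
      using digit_cost_diff_power[of p "p + q" n] by simp
    then show ?thesis
      using act h len LAi
      by (intro exI[of _ "n - 2 ^ p"] exI[of _ p] exI[of _ q]) (simp add: field_simps)
  next
    case LT
    show ?thesis
    proof (cases p)
      case 0
      then show ?thesis
        using act h len LT digit_cost_double[of q n]
        by (intro exI[of _ "2 * n"] exI[of _ 0] exI[of _ "Suc q"]) simp
    next
      case (Suc p')
      then show ?thesis
        using act h len LT
        by (intro exI[of _ n] exI[of _ p'] exI[of _ "Suc q"]) simp
    qed
  next
    case LTi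
    show ?thesis
    proof (cases q)
      case 0
      then show ?thesis
        using act h len LTi digit_cost_Suc_le[of p n]
        by (intro exI[of _ n] exI[of _ "Suc p"] exI[of _ 0]) simp
    next
      case (Suc q')
      then show ?thesis
        using act h len LTi
        by (intro exI[of _ n] exI[of _ "Suc p"] exI[of _ q']) simp
    qed
  qed
qed

text \<open>
  The criterion only has to look at walks of the same depth \<open>p\<close>. A competitor that is less
  deep cannot exist: it would not come down to the final height, or could not produce the odd
  numerator \<open>n\<close>. A
  competitor that is deeper by \<open>i\<close> writes \<open>n * 2 ^ i\<close>, whose digits cost the same as
  those of \<open>n\<close>.
\<close>

lemma geodesicI:
  assumes act: "act w 0 = of_int n / 2 ^ p"
    and depth: "p = 0 \<or> height w = - int p \<or> odd n"
    and len: "int (length w) + \<bar>height w\<bar> \<le> digit_cost L n + 2 * int L"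
    and opt: "\<And>K. int p \<le> int K \<Longrightarrow> int p + height w \<le> int K \<Longrightarrow>
                digit_cost L n + 2 * int L \<le> digit_cost K n + 2 * int K"
  shows "geodesic w"
  unfolding geodesic_def
proof (intro allI impI)
  fix v
  assume "bs_elem v = bs_elem w"
  then have eq: "bs_eq v w" by (simp add: bs_elem_eq_iff)
  have h: "height v = height w" and a: "act v 0 = act w 0"
    using bs_eq_height[OF eq] bs_eq_act[OF eq] by auto
  obtain n' p' q where act': "act v 0 = of_int n' / 2 ^ p'"
    and h': "- int p' \<le> height v" "height v \<le> int q"
    and len': "digit_cost (p' + q) n' + 2 * int (p' + q) \<le> int (length v) + \<bar>height v\<bar>"
    using length_lower_bound by blast
  have "of_int n' * 2 ^ p = (of_int n * 2 ^ p' :: real)"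
    using a act act' by (simp add: field_simps)
  then have "real_of_int (n' * 2 ^ p) = real_of_int (n * 2 ^ p')" by simp
  then have eqn: "n' * 2 ^ p = n * 2 ^ p'" by (simp only: of_int_eq_iff)
  have "p \<le> p'"
  proof (rule ccontr)
    assume less: "\<not> p \<le> p'"
    then have "odd n" using depth h h' by auto
    moreover obtain i where i: "p = p' + Suc i" using less less_imp_Suc_add by fastforce
    have "n = 2 * (n' * 2 ^ i)" using eqn by (simp add: i power_add)
    ultimately show False by simp
  qed
  then obtain i where i: "p' = p + i" using le_Suc_ex by blast
  have n': "n' = n * 2 ^ i" using eqn by (simp add: i power_add)
  have "digit_cost (p' + q) n' = digit_cost (p + q) n"
    using digit_cost_mult_power[of "p + q" i n] by (simp add: i n' ac_simps)
  moreover have "digit_cost L n + 2 * int L \<le> digit_cost (p + q) n + 2 * int (p + q)"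
    using h h' by (intro opt) auto
  ultimately show "length w \<le> length v"
    using len len' h i by simp
qed

section \<open>Runs and their digit sequences\<close>

text \<open>
  Digit sequences start with the least significant digit. This is the order of the entries in a
  \<open>P\<close>-run; for an \<open>N\<close>-run the entries have to be reversed.
\<close>

fun digit_value :: "int list \<Rightarrow> int" where
  "digit_value [] = 0"
| "digit_value (d # ds) = d + 2 * digit_value ds"

definition digit_sum :: "int list \<Rightarrow> int" where
  "digit_sum ds = sum_list (map abs ds)"

lemma digit_sum_simps [simp]:
  "digit_sum [] = 0" "digit_sum (d # ds) = \<bar>d\<bar> + digit_sum ds"
  "digit_sum (ds @ es) = digit_sum ds + digit_sum es" "digit_sum (rev ds) = digit_sum ds"
  by (simp_all add: digit_sum_def sum_list_rev rev_map[symmetric])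

lemma digit_value_snoc: "digit_value (ds @ [e]) = digit_value ds + e * 2 ^ length ds"
  by (induction ds) (auto simp: algebra_simps)

lemma act_replicate:
  "act (replicate k LA) z = z + real k" "act (replicate k LAi) z = z - real k"
  "act (replicate k LT) z = 2 ^ k * z" "act (replicate k LTi) z = z / 2 ^ k"
  by (induction k) auto

lemma height_replicate: "height (replicate k x) = int k * letter_height x"
  by (induction k) (auto simp: algebra_simps)

lemma a_pow_simps:
  "act (a_pow i) z = z + of_int i" "height (a_pow i) = 0" "int (length (a_pow i)) = \<bar>i\<bar>"
  by (auto simp: act_replicate height_replicate)

declare a_pow.simps [simp del]

lemma height_run: "ds \<noteq> [] \<Longrightarrow> height (run x ds) = int (length ds - 1) * letter_height x"
  by (induction x ds rule: run.induct) (auto simp: a_pow_simps algebra_simps)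

lemma length_run: "ds \<noteq> [] \<Longrightarrow> int (length (run x ds)) = int (length ds - 1) + digit_sum ds"
  by (induction x ds rule: run.induct) (auto simp: a_pow_simps)

lemma act_p_run:
  "ds \<noteq> [] \<Longrightarrow> act (p_run ds) z = of_int (digit_value ds) + 2 ^ (length ds - 1) * z"
  by (induction LT ds rule: run.induct) (auto simp: a_pow_simps algebra_simps)

lemma act_n_run:
  "es \<noteq> [] \<Longrightarrow> act (n_run es) z = (of_int (digit_value (rev es)) + z) / 2 ^ (length es - 1)"
proof (induction LTi es rule: run.induct)
  case (3 e f es)
  have "digit_value (rev (e # f # es)) = digit_value (rev (f # es)) + e * 2 ^ Suc (length es)"
    using digit_value_snoc[of "rev (f # es)" e] by simp
  then show ?case
    using 3 by (simp add: a_pow_simps field_simps del: rev.simps)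
qed (auto simp: a_pow_simps)

text \<open>
  The size bound ensures that no higher top position is better. It is stronger than the factor
  \<open>5\<close> of \<open>digit_cost_extra_level\<close> and strict because in this form it survives
  \<open>n \<mapsto> d + 2 * n\<close> with \<open>\<bar>d\<bar> \<le> 1\<close>.
\<close>

definition optimal_digits :: "int list \<Rightarrow> bool" where
  "optimal_digits ds \<longleftrightarrow> ds \<noteq> [] \<and>
     digit_sum ds = digit_cost (length ds - 1) (digit_value ds) \<and>
     \<bar>digit_value ds\<bar> < 4 * 2 ^ (length ds - 1)"

definition optimal_level :: "int list \<Rightarrow> bool" where
  "optimal_level ds \<longleftrightarrow> (\<forall>K. digit_cost (length ds - 1) (digit_value ds) + 2 * int (length ds - 1)
      \<le> digit_cost K (digit_value ds) + 2 * int K)"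

lemma optimal_digits_above:
  assumes "optimal_digits ds" "length ds - 1 \<le> K"
  shows "digit_cost (length ds - 1) (digit_value ds) + 2 * int (length ds - 1)
      \<le> digit_cost K (digit_value ds) + 2 * int K"
proof -
  obtain j where "K = length ds - 1 + j" using assms(2) le_Suc_ex by blast
  moreover have "\<bar>digit_value ds\<bar> \<le> 5 * 2 ^ (length ds - 1)"
    using assms(1) zero_le_power[of "2 :: int" "length ds - 1"]
    unfolding optimal_digits_def by linarith
  ultimately show ?thesis
    using digit_cost_more_levels[of "digit_value ds" "length ds - 1" j] by simp
qed

lemma optimal_level_if_large:
  assumes "optimal_digits ds" "2 * 2 ^ (length ds - 1) \<le> \<bar>digit_value ds\<bar>"
  shows "optimal_level ds"
  unfolding optimal_level_def
proof
  fix K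
  show "digit_cost (length ds - 1) (digit_value ds) + 2 * int (length ds - 1)
      \<le> digit_cost K (digit_value ds) + 2 * int K"
  proof (cases "length ds - 1 \<le> K")
    case False
    then have "K \<le> length ds - 1" by simp
    then obtain j where "length ds - 1 = K + j" by (auto dest: le_Suc_ex)
    then show ?thesis
      using digit_cost_fewer_levels[of K j "digit_value ds"] assms(2) by simp
  qed (rule optimal_digits_above[OF assms(1)])
qed

text \<open>
  A single comparison with the level directly below the top is enough when
  \<open>\<bar>n\<bar>\<close> is at least \<open>2 ^ L\<close>: all levels further down fall under
  \<open>digit_cost_fewer_levels\<close>, which needs a much smaller bound there.
\<close>

lemma optimal_level_if_next_worse:
  assumes "optimal_digits ds" "2 \<le> length ds" "2 ^ (length ds - 1) \<le> \<bar>digit_value ds\<bar>"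
    and "digit_cost (length ds - 1) (digit_value ds) + 2 \<le> digit_cost (length ds - 2) (digit_value ds)"
  shows "optimal_level ds"
  unfolding optimal_level_def
proof
  fix K
  let ?n = "digit_value ds"
  show "digit_cost (length ds - 1) ?n + 2 * int (length ds - 1) \<le> digit_cost K ?n + 2 * int K"
  proof (cases "length ds - 1 \<le> K")
    case True
    then show ?thesis using optimal_digits_above[OF assms(1)] by simp
  next
    case False
    then have "K \<le> length ds - 2" by simp
    then obtain j where j: "length ds - 2 = K + j" by (auto dest: le_Suc_ex)
    have l: "length ds - 1 = Suc (length ds - 2)" using assms(2) by simp
    have "digit_cost (K + j) ?n + 2 * int j \<le> digit_cost K ?n"
      using assms(3) by (intro digit_cost_fewer_levels) (simp add: l j[symmetric] del: One_nat_def)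
    then show ?thesis using assms(4) unfolding l j by simp
  qed
qed

text \<open>
  The walk of the word ends at height \<open>k + m - l\<close> and has depth \<open>l - k\<close>, where
  \<open>l = length es - 1\<close>. If
  \<open>m > 0\<close> it went below its end, which an odd numerator justifies; if \<open>k > 0\<close> it went
  above \<open>0\<close>, so that lower top positions have to be ruled out as well.
\<close>

lemma geodesic_n_run:
  assumes "optimal_digits (rev es)" and "k + m \<le> length es - 1"
    and "m = 0 \<or> odd (digit_value (rev es))"
    and "k = 0 \<or> optimal_level (rev es)"
  shows "geodesic (replicate k LT @ n_run es @ replicate m LT)" (is "geodesic ?w")
proof -
  let ?l = "length es - 1" and ?n = "digit_value (rev es)"
  have ne: "es \<noteq> []" using assms(1) by (auto simp: optimal_digits_def)
  have h: "height ?w = int k + int m - int ?l"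
    using height_run[OF ne, of LTi] by (simp add: height_replicate)
  obtain p where p: "?l = p + k" using assms(2) by (metis add.commute le_Suc_ex le_add1 order_trans)
  show ?thesis
  proof (rule geodesicI)
    show "act ?w 0 = of_int ?n / 2 ^ p"
      using act_n_run[OF ne, of 0] unfolding p by (simp add: act_replicate power_add)
    show "p = 0 \<or> height ?w = - int p \<or> odd ?n"
      using assms(3) h p by auto
    show "int (length ?w) + \<bar>height ?w\<bar> \<le> digit_cost ?l ?n + 2 * int ?l"
      using length_run[OF ne, of LTi] h assms(1,2) by (simp add: optimal_digits_def)
    show "digit_cost ?l ?n + 2 * int ?l \<le> digit_cost K ?n + 2 * int K"
      if "int p \<le> int K" "int p + height ?w \<le> int K" for K
      using assms(4)
    proof
      assume "k = 0"
      then show ?thesis using optimal_digits_above[OF assms(1), of K] that p by simp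
    qed (simp add: optimal_level_def)
  qed
qed

text \<open>
  As for \<open>N\<close>-runs, with the roles of \<open>k\<close> and \<open>m\<close> interchanged: now
  \<open>k > 0\<close> means a descent below the start and \<open>m > 0\<close> a rise above the end.
\<close>

lemma geodesic_p_run:
  assumes "optimal_digits ds" and "k + m \<le> length ds - 1"
    and "k = 0 \<or> odd (digit_value ds)"
    and "m = 0 \<or> optimal_level ds"
  shows "geodesic (replicate k LTi @ p_run ds @ replicate m LTi)" (is "geodesic ?w")
proof -
  let ?l = "length ds - 1" and ?n = "digit_value ds"
  have ne: "ds \<noteq> []" using assms(1) by (auto simp: optimal_digits_def)
  have h: "height ?w = int ?l - int k - int m"
    using height_run[OF ne, of LT] by (simp add: height_replicate)
  show ?thesis
  proof (rule geodesicI)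
    show "act ?w 0 = of_int ?n / 2 ^ k"
      using act_p_run[OF ne, of 0] by (simp add: act_replicate)
    show "k = 0 \<or> height ?w = - int k \<or> odd ?n"
      using assms(3) by auto
    show "int (length ?w) + \<bar>height ?w\<bar> \<le> digit_cost ?l ?n + 2 * int ?l"
      using length_run[OF ne, of LT] h assms(1,2) by (simp add: optimal_digits_def)
    show "digit_cost ?l ?n + 2 * int ?l \<le> digit_cost K ?n + 2 * int K"
      if "int k \<le> int K" "int k + height ?w \<le> int K" for K
      using assms(4)
    proof
      assume "m = 0"
      then show ?thesis using optimal_digits_above[OF assms(1), of K] that h by simp
    qed (simp add: optimal_level_def)
  qed
qed

section \<open>Digit sequences of normal forms\<close>

definition sparse_below_top :: "int list \<Rightarrow> bool" where
  "sparse_below_top ds \<longleftrightarrow>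
     (\<forall>i. i + 3 < length ds \<longrightarrow> ds ! i \<in> {0, 1, -1} \<and> (ds ! i \<noteq> 0 \<longrightarrow> ds ! (i + 1) = 0))"

lemma sparse_below_top_Cons:
  assumes "sparse_below_top (d # e # ds)" "2 \<le> length ds"
  shows "sparse_below_top (e # ds)" and "d \<in> {0, 1, -1}" and "d \<noteq> 0 \<Longrightarrow> e = 0"
proof -
  show "sparse_below_top (e # ds)"
    unfolding sparse_below_top_def
  proof (intro allI impI)
    fix i assume "i + 3 < length (e # ds)"
    then show "(e # ds) ! i \<in> {0, 1, -1} \<and> ((e # ds) ! i \<noteq> 0 \<longrightarrow> (e # ds) ! (i + 1) = 0)"
      using assms(1)[unfolded sparse_below_top_def, rule_format, of "Suc i"] by simp
  qed
  show "d \<in> {0, 1, -1}" and "d \<noteq> 0 \<Longrightarrow> e = 0"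
    using assms(1)[unfolded sparse_below_top_def, rule_format, of 0] assms(2) by auto
qed

text \<open>
  Induction on the low digits in \<open>r\<close>. The estimate for the position below the top has to be
  carried along from the leading triple, because size alone does not give it: for the digits
  \<open>-1, 0, 0, 2\<close> the value is \<open>15\<close>, just below the bound \<open>4 * 2 ^ 2\<close> in
  \<open>digit_cost_missing_level\<close>.
\<close>

lemma sparse_digits:
  assumes "sparse_below_top (r @ s)" "length s = 3" "optimal_digits s"
  shows "optimal_digits (r @ s)"
    and "8 \<le> \<bar>digit_value s\<bar> \<Longrightarrow>
      2 ^ (length r + 2) < \<bar>digit_value (r @ s)\<bar> \<and>
      digit_cost (length r + 2) (digit_value (r @ s)) + 2
        \<le> digit_cost (length r + 1) (digit_value (r @ s))"
proof -
  have "optimal_digits (r @ s) \<and> (8 \<le> \<bar>digit_value s\<bar> \<longrightarrow>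
      2 ^ (length r + 2) < \<bar>digit_value (r @ s)\<bar> \<and>
      digit_cost (length r + 2) (digit_value (r @ s)) + 2
        \<le> digit_cost (length r + 1) (digit_value (r @ s)))"
    using assms(1)
  proof (induction r)
    case Nil
    then show ?case
      using assms(2,3) digit_cost_missing_level[of 1 "digit_value s"]
      by (auto simp: numeral_2_eq_2)
  next
    case (Cons d r)
    let ?n = "digit_value (r @ s)"
    obtain e ds where eds: "r @ s = e # ds" using assms(2) by (cases "r @ s") auto
    have len: "2 \<le> length ds" using assms(2) arg_cong[OF eds, of length] by simp
    have sp: "sparse_below_top (d # e # ds)" using Cons.prems eds by simp
    note S = sparse_below_top_Cons[OF sp len]
    have IH: "optimal_digits (r @ s)" "8 \<le> \<bar>digit_value s\<bar> \<Longrightarrow>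
      2 ^ (length r + 2) < \<bar>?n\<bar> \<and>
      digit_cost (length r + 2) ?n + 2 \<le> digit_cost (length r + 1) ?n"
      using Cons.IH S(1) eds by auto
    have cost: "digit_cost (Suc L) (d + 2 * ?n) = \<bar>d\<bar> + digit_cost L ?n" if "1 \<le> L" for L
    proof (cases "d = 0")
      case False
      then have "even ?n" using S(3) eds by simp
      then show ?thesis using digit_cost_odd_step[of ?n L d] False S(2) that by auto
    qed (simp add: digit_cost_Suc)
    have lens: "length (r @ s) - 1 = length r + 2" "length ((d # r) @ s) - 1 = Suc (length r + 2)"
      using assms(2) by auto
    have "optimal_digits ((d # r) @ s)"
      using IH(1) cost[of "length r + 2"] S(2) unfolding optimal_digits_def lens
      by auto
    moreover have "2 ^ (length (d # r) + 2) < \<bar>digit_value ((d # r) @ s)\<bar> \<and>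
      digit_cost (length (d # r) + 2) (digit_value ((d # r) @ s)) + 2
        \<le> digit_cost (length (d # r) + 1) (digit_value ((d # r) @ s))"
      if "8 \<le> \<bar>digit_value s\<bar>"
      using IH(2)[OF that] cost[of "length r + 2"] cost[of "length r + 1"] S(2) by auto
    ultimately show ?case by blast
  qed
  then show "optimal_digits (r @ s)"
    and "8 \<le> \<bar>digit_value s\<bar> \<Longrightarrow>
      2 ^ (length r + 2) < \<bar>digit_value (r @ s)\<bar> \<and>
      digit_cost (length r + 2) (digit_value (r @ s)) + 2
        \<le> digit_cost (length r + 1) (digit_value (r @ s))"
    by blast+
qed

lemma p_longE:
  assumes "p_long S ds" "\<forall>s\<in>S. length s = 3"
  obtains r s where "ds = r @ s" "s \<in> with_neg S" "length s = 3" "sparse_below_top ds"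
proof -
  obtain r s where rs: "ds = r @ s" "s \<in> with_neg S" "set r \<subseteq> {0, 1, -1}"
    and adj: "\<forall>i. i + 1 < length ds \<longrightarrow> ds ! i \<noteq> 0 \<longrightarrow> ds ! (i + 1) \<noteq> 0 \<longrightarrow> length ds \<le> i + 3"
    using assms(1) unfolding p_long_def by blast
  have s: "length s = 3" using rs(2) assms(2) by (auto simp: with_neg_def)
  have "sparse_below_top ds"
    unfolding sparse_below_top_def
  proof (intro allI impI)
    fix i assume i: "i + 3 < length ds"
    then have "ds ! i \<in> set r" using rs(1) s by (auto simp: nth_append)
    then show "ds ! i \<in> {0, 1, -1} \<and> (ds ! i \<noteq> 0 \<longrightarrow> ds ! (i + 1) = 0)"
      using adj[rule_format, of i] i rs(3) by auto
  qed
  then show thesis using that rs(1,2) s by blast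
qed

text \<open>
  The prefixes of \<open>N\<close>-runs are the reversed suffixes of \<open>P\<close>-runs, so all long
  sequences can be treated as \<open>P\<close>-runs.
\<close>

lemma n_long_rev:
  assumes "n_long S es"
  shows "p_long (rev ` S) (rev es)"
proof -
  obtain p r where pr: "es = p @ r" "p \<in> with_neg S" "set r \<subseteq> {0, 1, -1}"
    and adj: "\<forall>i. i + 1 < length es \<longrightarrow> es ! i \<noteq> 0 \<longrightarrow> es ! (i + 1) \<noteq> 0 \<longrightarrow> i + 1 < 3"
    using assms unfolding n_long_def by blast
  have "rev p \<in> with_neg (rev ` S)"
    using pr(2) by (auto simp: with_neg_def rev_map)
  moreover have "rev es = rev r @ rev p" "set (rev r) \<subseteq> {0, 1, -1}"
    using pr by auto
  moreover have "length (rev es) \<le> i + 3"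
    if "i + 1 < length (rev es)" "rev es ! i \<noteq> 0" "rev es ! (i + 1) \<noteq> 0" for i
  proof -
    let ?j = "length es - 2 - i"
    have "rev es ! i = es ! (?j + 1)" "rev es ! (i + 1) = es ! ?j"
      using that(1) by (simp_all add: rev_nth) (simp add: Suc_diff_Suc numeral_2_eq_2)
    moreover have "?j + 1 < length es" using that(1) by auto
    ultimately have "?j + 1 < 3" using adj that(2,3) by metis
    then show ?thesis by simp
  qed
  ultimately show ?thesis unfolding p_long_def by blast
qed

lemma suf_P_optimal: "\<forall>s\<in>with_neg suf_P. optimal_digits s"
  by (simp add: suf_P_def optimal_digits_def with_neg_def digit_cost.simps(2))

text \<open>
  The number \<open>8 = 4 * 2 ^ 1\<close> is the bound of \<open>digit_cost_missing_level\<close> at the position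
  below the top of a triple.
\<close>

lemma suf_PX_optimal: "\<forall>s\<in>with_neg suf_PX. optimal_digits s \<and> 8 \<le> \<bar>digit_value s\<bar>"
  by (simp add: suf_PX_def optimal_digits_def with_neg_def digit_cost.simps(2))

lemma rev_pre: "rev ` pre_N = suf_P" "rev ` pre_X = suf_PX"
  by (simp_all add: pre_N_def pre_X_def suf_P_def suf_PX_def)

lemma suf_length: "\<forall>s\<in>suf_P. length s = 3" "\<forall>s\<in>suf_PX. length s = 3"
  by (simp_all add: suf_P_def suf_PX_def)

lemma p_long_suf_P:
  assumes "p_long suf_P ds"
  shows "optimal_digits ds"
  using p_longE[OF assms suf_length(1)] suf_P_optimal sparse_digits(1) by metis

lemma p_long_suf_PX:
  assumes "p_long suf_PX ds"
  shows "optimal_digits ds" and "optimal_level ds"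
proof -
  obtain r s where rs: "ds = r @ s" "s \<in> with_neg suf_PX" "length s = 3" "sparse_below_top ds"
    using p_longE[OF assms suf_length(2)] by metis
  have s: "optimal_digits s" "8 \<le> \<bar>digit_value s\<bar>" using suf_PX_optimal rs(2) by auto
  show opt: "optimal_digits ds"
    using sparse_digits(1)[of r s] rs s by simp
  have len: "length ds - 1 = length r + 2" "length ds - 2 = length r + 1" "2 \<le> length ds"
    using rs(1,3) by auto
  show "optimal_level ds"
    using sparse_digits(2)[of r s] rs s opt unfolding rs(1)[symmetric]
    by (intro optimal_level_if_next_worse) (simp_all only: len(1,2), simp_all add: len(3))
qed

lemma p_long_odd:
  assumes "p_long S ds" "4 \<le> length ds" "\<forall>s\<in>S. length s = 3" "hd ds \<noteq> 0"
  shows "odd (digit_value ds)"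
proof -
  have sp: "sparse_below_top ds" using p_longE[OF assms(1,3)] by metis
  obtain d ds' where ds: "ds = d # ds'" using assms(2) by (cases ds) auto
  have "d \<in> {0, 1, -1}" "d \<noteq> 0"
    using sp[unfolded sparse_below_top_def, rule_format, of 0] assms(2,4) ds by auto
  then show ?thesis using ds by auto
qed

section \<open>Normal form words are geodesic\<close>

lemma NF1_geodesic:
  assumes "w \<in> NF1"
  shows "geodesic w"
proof -
  obtain i where "w = p_run [i]" "\<bar>i\<bar> \<le> 3" using assms by (auto simp: NF1_def)
  then show ?thesis
    using geodesic_p_run[of "[i]" 0 0] by (simp add: optimal_digits_def)
qed

lemma n_long_geodesic:
  assumes "n_long S es" "rev ` S = suf_P \<or> rev ` S = suf_PX" "length es = l + 1" "3 \<le> l"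
    and "k + m \<le> l" "0 < m \<Longrightarrow> last es \<noteq> 0" "0 < k \<Longrightarrow> rev ` S = suf_PX"
  shows "geodesic (replicate k LT @ n_run es @ replicate m LT)"
proof (rule geodesic_n_run)
  have ne: "es \<noteq> []" using assms(3) by auto
  have S: "\<forall>s\<in>rev ` S. length s = 3" using assms(2) suf_length by metis
  have len: "4 \<le> length (rev es)" using assms(3,4) by simp
  note long = n_long_rev[OF assms(1)]
  show "optimal_digits (rev es)"
    using assms(2) long p_long_suf_P p_long_suf_PX by metis
  show "k + m \<le> length es - 1" using assms(3,5) by simp
  show "m = 0 \<or> odd (digit_value (rev es))"
    using p_long_odd[OF long len S] assms(6) ne by (auto simp: hd_rev)
  show "k = 0 \<or> optimal_level (rev es)"
    using assms(7) long p_long_suf_PX(2) by (cases "k = 0") auto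
qed

lemma p_long_geodesic:
  assumes "p_long S ds" "S = suf_P \<or> S = suf_PX" "length ds = l + 1" "3 \<le> l"
    and "k + m \<le> l" "0 < k \<Longrightarrow> hd ds \<noteq> 0" "0 < m \<Longrightarrow> S = suf_PX"
  shows "geodesic (replicate k LTi @ p_run ds @ replicate m LTi)"
proof (rule geodesic_p_run)
  have len: "4 \<le> length ds" using assms(3,4) by simp
  show "optimal_digits ds"
    using assms(1,2) p_long_suf_P p_long_suf_PX by metis
  show "k + m \<le> length ds - 1" using assms(3,5) by simp
  show "k = 0 \<or> odd (digit_value ds)"
    using p_long_odd[OF assms(1) len] assms(2,6) suf_length by auto
  show "m = 0 \<or> optimal_level ds"
    using assms(1,7) p_long_suf_PX(2) by auto
qed

text \<open>
  \<open>lo\<close> and \<open>hi\<close> tell whether the walk goes below, respectively above, both of its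
  end heights. The conditions are decidable by evaluation; the last one replaces the quantification
  over all levels in \<open>optimal_level\<close>.
\<close>

definition short_digits :: "bool \<Rightarrow> bool \<Rightarrow> int list \<Rightarrow> bool" where
  "short_digits lo hi ds \<longleftrightarrow> optimal_digits ds \<and> (lo \<longrightarrow> odd (digit_value ds)) \<and>
     (hi \<longrightarrow> 2 * 2 ^ (length ds - 1) \<le> \<bar>digit_value ds\<bar>)"

lemma geodesic_short_n_run:
  assumes "w = replicate k LT @ n_run es @ replicate m LT"
    and "short_digits (m > 0) (k > 0) (rev es) \<and> k + m \<le> length es - 1"
  shows "geodesic w"
  unfolding assms(1) using assms(2) optimal_level_if_large[of "rev es"]
  by (intro geodesic_n_run) (auto simp: short_digits_def)

lemma geodesic_short_p_run:
  assumes "w = replicate k LTi @ p_run ds @ replicate m LTi"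
    and "short_digits (k > 0) (m > 0) ds \<and> k + m \<le> length ds - 1"
  shows "geodesic w"
  unfolding assms(1) using assms(2) optimal_level_if_large[of ds]
  by (intro geodesic_p_run) (auto simp: short_digits_def)

lemmas short_digits_eval = short_digits_def optimal_digits_def digit_cost.simps(2)

lemma L1_geodesic: "w \<in> L1 \<Longrightarrow> geodesic w"
  unfolding L1_def
  apply (elim UnE imageE)
  subgoal for es
    by (rule geodesic_short_n_run[of w 1 es 0],
      simp add: numeral_2_eq_2, elim insertE emptyE; simp add: short_digits_eval)
  subgoal for es
    by (rule geodesic_short_n_run[of w 1 es 0],
      simp add: numeral_2_eq_2, elim insertE emptyE; simp add: short_digits_eval)
  subgoal for es
    by (rule geodesic_short_n_run[of w 2 es 0],
      simp add: numeral_2_eq_2, elim insertE emptyE; simp add: short_digits_eval)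
  subgoal for es
    by (rule geodesic_short_n_run[of w 1 es 1],
      simp add: numeral_2_eq_2, elim insertE emptyE; simp add: short_digits_eval)
  done

lemma L3_geodesic: "w \<in> L3 \<Longrightarrow> geodesic w"
  unfolding L3_def
  apply (elim UnE imageE)
  subgoal for ds
    by (rule geodesic_short_p_run[of w 0 ds 0],
      simp add: numeral_2_eq_2, elim insertE emptyE; simp add: short_digits_eval)
  subgoal for ds
    by (rule geodesic_short_p_run[of w 1 ds 0],
      simp add: numeral_2_eq_2, elim insertE emptyE; simp add: short_digits_eval)
  subgoal for ds
    by (rule geodesic_short_p_run[of w 0 ds 0],
      simp add: numeral_2_eq_2, elim insertE emptyE; simp add: short_digits_eval)
  subgoal for ds
    by (rule geodesic_short_p_run[of w 1 ds 0],
      simp add: numeral_2_eq_2, elim insertE emptyE; simp add: short_digits_eval)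
  subgoal for ds
    by (rule geodesic_short_p_run[of w 2 ds 0],
      simp add: numeral_2_eq_2, elim insertE emptyE; simp add: short_digits_eval)
  done

lemma L4_geodesic: "w \<in> L4 \<Longrightarrow> geodesic w"
  unfolding L4_def
  apply (elim UnE imageE)
  subgoal for ds
    by (rule geodesic_short_p_run[of w 0 ds 1],
      simp add: numeral_2_eq_2, elim insertE emptyE; simp add: short_digits_eval)
  done

text \<open>
  Each list in \<open>L2\<close> is checked entry by entry, and for an entry that violates
  \<open>short_digits\<close> the word lies in \<open>L2_nongeodesic\<close>. The exceptional lists are matched by
  unification with the image \<open>f ` B\<close>.
\<close>

lemma geodesic_short_n_run_except:
  assumes "w \<notin> f ` B" "w = f es" "\<And>es. f es = n_run es @ replicate m LT"
    and "es \<in> B \<or> short_digits (m > 0) False (rev es) \<and> m \<le> length es - 1"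
  shows "geodesic w"
  using assms geodesic_short_n_run[of w 0 es m] by auto

lemma L2_geodesic: "w \<in> L2 \<Longrightarrow> w \<notin> L2_nongeodesic \<Longrightarrow> geodesic w"
  unfolding L2_def L2_nongeodesic_def Un_iff de_Morgan_disj
  apply (elim conjE)
  apply (elim disjE imageE)
  subgoal for es
    by (rule geodesic_short_n_run_except[of w _ _ es 0], assumption, assumption,
      simp add: numeral_2_eq_2, elim insertE emptyE; simp add: short_digits_eval)
  subgoal for es
    by (rule geodesic_short_n_run_except[of w _ _ es 1], assumption, assumption,
      simp add: numeral_2_eq_2, elim insertE emptyE; simp add: short_digits_eval)
  subgoal for es
    by (rule geodesic_short_n_run_except[of w _ _ es 0], assumption, assumption,
      simp add: numeral_2_eq_2, elim insertE emptyE; simp add: short_digits_eval)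
  subgoal for es
    by (rule geodesic_short_n_run_except[of w _ _ es 1], assumption, assumption,
      simp add: numeral_2_eq_2, elim insertE emptyE; simp add: short_digits_eval)
  subgoal for es
    by (rule geodesic_short_n_run_except[of w _ _ es 2], assumption, assumption,
      simp add: numeral_2_eq_2, elim insertE emptyE; simp add: short_digits_eval)
  done

theorem lemma22:
  fixes w :: word
  assumes "w \<in> NF" and "w \<notin> L2_nongeodesic"
  shows "geodesic w"
proof -
  consider "w \<in> NF1" | "w \<in> NF2" | "w \<in> NF3" | "w \<in> NF4" | "w \<in> NF5"
    using assms(1) unfolding NF_def by blast
  then show ?thesis
  proof cases
    case 1
    then show ?thesis by (rule NF1_geodesic)
  next
    case 2
    then obtain k m l es where w: "w = replicate k LT @ n_run es @ replicate m LT"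
      and "length es = l + 1" "k + m \<le> l" "m > 0 \<longrightarrow> last es \<noteq> 0"
      and "if 3 \<le> l then n_long pre_X es else w \<in> L1"
      unfolding NF2_def by blast
    then show ?thesis
      using n_long_geodesic[of pre_X es l k m] L1_geodesic[of w] rev_pre
      by (auto split: if_splits)
  next
    case 3
    then obtain k l es where w: "w = n_run es @ replicate k LT"
      and "length es = l + 1" "k \<le> l" "k > 0 \<longrightarrow> last es \<noteq> 0"
      and "if 3 \<le> l then n_long pre_N es else w \<in> L2"
      unfolding NF3_def by blast
    then show ?thesis
      using n_long_geodesic[of pre_N es l 0 k] L2_geodesic[of w] rev_pre assms(2)
      by (auto split: if_splits)
  next
    case 4
    then obtain k l es where w: "w = replicate k LTi @ p_run es"
      and "length es = l + 1" "k < l" "k > 0 \<longrightarrow> hd es \<noteq> 0"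
      and "if 3 \<le> l then p_long suf_P es else w \<in> L3"
      unfolding NF4_def by blast
    then show ?thesis
      using p_long_geodesic[of suf_P es l k 0] L3_geodesic[of w]
      by (auto split: if_splits)
  next
    case 5
    then obtain k m l es where w: "w = replicate k LTi @ p_run es @ replicate m LTi"
      and "length es = l + 1" "k + m < l" "k > 0 \<longrightarrow> hd es \<noteq> 0"
      and "if 3 \<le> l then p_long suf_PX es else w \<in> L4"
      unfolding NF5_def by blast
    then show ?thesis
      using p_long_geodesic[of suf_PX es l k m] L4_geodesic[of w]
      by (auto split: if_splits)
  qed
qed

end
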